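(* Let $\Lambda$ be a subset of $\mathbb{N}$ and let $f_\Lambda(z)=\sum_{n\in\Lambda}z^n$ for $z\in\mathbb{D}$. Then $f_\Lambda\in\mathcal{B}$ if and only if $\Lambda$ is a finite union of lacunary subsets of $\mathbb{N}$.
   Context: $\mathbb{N}=\{0,1,2,\dots\}$; $\mathbb{D}$ is the open unit disc in $\mathbb{C}$. Bloch space: $\mathcal{B}=\{f \text{ holomorphic on } \mathbb{D} : \|f\|_{\mathcal{B}}:=\sup_{z\in\mathbb{D}}(1-|z|)|f'(z)|<\infty\}$. Lacunary: a subset $\Lambda=\{\lambda_1,\lambda_2,\dots\}\subset\mathbb{N}$ with $\lambda_1<\lambda_2<\cdots$ is lacunary if $\rho_\Lambda:=\liminf_{k\to\infty}\lambda_{k+1}/\lambda_k>1$. Finite subsets (including the empty set) are regarded as lacunary. *)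

theory Defs
  imports "HOL-Complex_Analysis.Complex_Analysis"
begin

definition bloch_norm :: "(complex \<Rightarrow> complex) \<Rightarrow> ereal" where
  "bloch_norm f = (SUP z\<in>ball 0 1. ereal ((1 - norm z) * norm (deriv f z)))"

(* Functions on the disc are represented by total functions; their values outside
   the open unit disc play no role. *)
definition bloch_space :: "(complex \<Rightarrow> complex) set" where
  "bloch_space = {f. f holomorphic_on ball 0 1 \<and> bloch_norm f < \<infinity>}"

(* For infinite L, enumerate L is the increasing enumeration, indexed from 0.  If 0 is in L,
   the first quotient is x / 0 = 0; this does not affect the lower limit. *)
definition lacunary_ratio :: "nat set \<Rightarrow> ereal" where
  "lacunary_ratio L =
     liminf (\<lambda>k. ereal (real (enumerate L (Suc k)) / real (enumerate L k)))"

definition lacunary :: "nat set \<Rightarrow> bool" where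
  "lacunary L \<longleftrightarrow> finite L \<or> lacunary_ratio L > 1"

definition power_sum_over :: "nat set \<Rightarrow> complex \<Rightarrow> complex" where
  "power_sum_over L z = (\<Sum>\<^sub>\<infinity>n\<in>L. z ^ n)"

end

theory Submission
  imports Defs
begin

text \<open>
  Everything is equivalent to the linear growth of \<open>A(N) = (\<Sum>n\<in>\<Lambda>, n \<le> N. n)\<close>, that is,
  to \<open>A(N) \<le> C N\<close>. Evaluating the derivative at \<open>1 - 1/(2N)\<close> shows that Bloch functions satisfy
  this bound; conversely Abel summation gives
  \<open>(\<Sum>n\<in>\<Lambda>. n r\<^sup>n\<^sup>-\<^sup>1) \<le> C (\<Sum>n\<ge>1. r\<^sup>n\<^sup>-\<^sup>1) = C / (1 - r)\<close>.
  A lacunary set satisfies it because the sum is dominated by a geometric one. If it holds, every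
  \<open>{x..2x}\<close> contains at most \<open>2C\<close> elements of \<open>\<Lambda>\<close>, so sorting the elements by
  their index modulo some \<open>M > 2C\<close> gives \<open>M\<close> lacunary sets.
\<close>

section \<open>Bloch functions and the power series of the derivative\<close>

lemma bloch_space_iff:
  "f \<in> bloch_space \<longleftrightarrow> f holomorphic_on ball 0 1 \<and>
    (\<exists>M. \<forall>z. norm z < 1 \<longrightarrow> (1 - norm z) * norm (deriv f z) \<le> M)"
proof -
  let ?B = "\<lambda>M. \<forall>z. norm z < 1 \<longrightarrow> (1 - norm z) * norm (deriv f z) \<le> M"
  have "bloch_norm f < \<infinity> \<longleftrightarrow> (\<exists>M. ?B M)"
  proof
    assume fin: "bloch_norm f < \<infinity>"
    have le: "ereal ((1 - norm z) * norm (deriv f z)) \<le> bloch_norm f" if "norm z < 1" for z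
      unfolding bloch_norm_def using that by (intro SUP_upper) simp
    \<comment> \<open>The point 0 supplies a finite lower bound, so the supremum is not minus
      infinity and is therefore real.\<close>
    from le[of 0] fin obtain M where "bloch_norm f = ereal M"
      by (cases "bloch_norm f") auto
    with le have "?B M"
      by auto
    then show "\<exists>M. ?B M" ..
  next
    assume "\<exists>M. ?B M"
    then obtain M where "?B M" ..
    then have "bloch_norm f \<le> ereal M"
      unfolding bloch_norm_def by (intro SUP_least) auto
    also have "\<dots> < \<infinity>"
      by simp
    finally show "bloch_norm f < \<infinity>" .
  qed
  then show ?thesis
    by (simp add: bloch_space_def)
qed

text \<open>Passing from a sum indexed by \<open>L\<close> to a power series with coefficients 0 and
  1 makes termwise differentiation available.\<close>

lemma power_sum_over_sums:
  assumes "norm z < 1"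
  shows "(\<lambda>n. of_bool (n \<in> L) * z ^ n) sums power_sum_over L z"
proof -
  have "summable (\<lambda>n. norm (of_bool (n \<in> L) * z ^ n))"
    by (rule summable_comparison_test[OF _ summable_geometric[of "norm z"]])
      (use assms in \<open>auto simp: norm_mult norm_power\<close>)
  then have "(\<lambda>n. of_bool (n \<in> L) * z ^ n) summable_on UNIV"
    by (rule norm_summable_imp_summable_on)
  then have "((\<lambda>n. of_bool (n \<in> L) * z ^ n) has_sum (\<Sum>\<^sub>\<infinity>n. of_bool (n \<in> L) * z ^ n)) UNIV"
    by (rule has_sum_infsum)
  moreover have "(\<Sum>\<^sub>\<infinity>n. of_bool (n \<in> L) * z ^ n) = power_sum_over L z"
    unfolding power_sum_over_def by (rule infsum_cong_neutral) auto
  ultimately show ?thesis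
    by (metis has_sum_imp_sums)
qed

lemma power_sum_over_holomorphic: "power_sum_over L holomorphic_on ball 0 1"
  by (rule power_series_holomorphic[where a = "\<lambda>n. of_bool (n \<in> L)"])
    (auto intro: power_sum_over_sums)

lemma deriv_power_sum_over_sums:
  assumes "norm z < 1"
  shows "(\<lambda>n. of_nat (Suc n) * of_bool (Suc n \<in> L) * z ^ n) sums deriv (power_sum_over L) z"
proof -
  define c :: "nat \<Rightarrow> complex" where "c = (\<lambda>n. of_bool (n \<in> L))"
  have sm: "summable (\<lambda>n. c n * w ^ n)" if "norm w < 1" for w
    using power_sum_over_sums[OF that] unfolding c_def by (rule sums_summable)
  have "((\<lambda>w. \<Sum>n. c n * w ^ n) has_field_derivative (\<Sum>n. diffs c n * z ^ n)) (at z)"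
    using termdiffs_strong'[of 1 c z] sm assms by blast
  then have "(power_sum_over L has_field_derivative (\<Sum>n. diffs c n * z ^ n)) (at z)"
  proof (rule has_field_derivative_transform_within_open)
    show "open (ball (0::complex) 1)" "z \<in> ball 0 1"
      using assms by auto
    show "(\<Sum>n. c n * w ^ n) = power_sum_over L w" if "w \<in> ball 0 1" for w
      using power_sum_over_sums[of w L] that by (simp add: c_def sums_iff)
  qed
  then have "deriv (power_sum_over L) z = (\<Sum>n. diffs c n * z ^ n)"
    by (rule DERIV_imp_deriv)
  moreover have "summable (\<lambda>n. diffs c n * z ^ n)"
    using termdiff_converges[OF assms sm] by blast
  ultimately have "(\<lambda>n. diffs c n * z ^ n) sums deriv (power_sum_over L) z"
    by (simp add: sums_iff)
  then show ?thesis
    by (simp add: diffs_def c_def)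
qed

text \<open>On the nonnegative real axis all terms are nonnegative, so nothing cancels and the norm
  is the series itself. This lets a bound on the derivative control partial sums.\<close>

lemma deriv_power_sum_over_real_sums:
  assumes "0 \<le> r" "r < 1"
  shows "(\<lambda>n. real (Suc n) * of_bool (Suc n \<in> L) * r ^ n) sums
    norm (deriv (power_sum_over L) (complex_of_real r))"
proof -
  let ?t = "\<lambda>n. real (Suc n) * of_bool (Suc n \<in> L) * r ^ n"
  have "(\<lambda>n. complex_of_real (?t n)) sums deriv (power_sum_over L) (complex_of_real r)"
    using deriv_power_sum_over_sums[of "complex_of_real r" L] assms by (simp add: of_bool_def if_distrib[of complex_of_real] cong: if_cong)
  moreover from this have "summable ?t"
    using sums_summable summable_complex_of_real by blast
  moreover from this have "(\<lambda>n. complex_of_real (?t n)) sums complex_of_real (suminf ?t)"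
    by (intro sums_of_real summable_sums)
  ultimately have "deriv (power_sum_over L) (complex_of_real r) = complex_of_real (suminf ?t)"
    using sums_unique2 by blast
  moreover have "0 \<le> suminf ?t"
    by (rule suminf_nonneg[OF \<open>summable ?t\<close>]) (use assms in auto)
  ultimately show ?thesis
    using \<open>summable ?t\<close> by (simp add: summable_sums)
qed

section \<open>Bloch membership and linear growth of the sums\<close>

lemma sum_Int_atMost_eq_sum_lessThan:
  fixes w :: "nat \<Rightarrow> real"
  shows "(\<Sum>n\<in>L \<inter> {..N}. real n * w n) =
    (\<Sum>n<N. real (Suc n) * of_bool (Suc n \<in> L) * w (Suc n))"
proof -
  have "(\<Sum>n\<in>L \<inter> {..N}. real n * w n) = (\<Sum>n\<le>N. real n * of_bool (n \<in> L) * w n)"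
    by (rule sum.mono_neutral_cong_left) auto
  also have "\<dots> = (\<Sum>n<N. real (Suc n) * of_bool (Suc n \<in> L) * w (Suc n))"
    by (simp add: sum.atMost_shift)
  finally show ?thesis .
qed

lemma sum_le_of_bloch:
  assumes "power_sum_over L \<in> bloch_space"
  obtains C :: real where "\<And>N. (\<Sum>n\<in>L \<inter> {..N}. real n) \<le> C * real N"
proof -
  obtain M where M: "\<And>z. norm z < 1 \<Longrightarrow> (1 - norm z) * norm (deriv (power_sum_over L) z) \<le> M"
    using assms unfolding bloch_space_iff by blast
  \<comment> \<open>One factor 2 comes from \<open>r ^ n \<ge> 1 / 2\<close> for
    \<open>n < N\<close>, the other from \<open>1 / (1 - r) = 2 * N\<close>.\<close>
  have "(\<Sum>n\<in>L \<inter> {..N}. real n) \<le> 4 * M * real N" for N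
  proof (cases "N = 0")
    case False
    define r where "r = 1 - 1 / (2 * real N)"
    have r: "0 \<le> r" "r < 1"
      using False by (auto simp: r_def field_simps)
    let ?D = "norm (deriv (power_sum_over L) (complex_of_real r))"
    \<comment> \<open>Bernoulli gives \<open>r ^ N \<ge> 1 - N / (2 * N)\<close>.\<close>
    have "1 / 2 \<le> r ^ N"
      using Bernoulli_inequality[of "- 1 / (2 * real N)" N] False
      by (simp add: r_def field_simps)
    then have half: "1 / 2 \<le> r ^ n" if "n < N" for n
      using power_decreasing[of n N r] that r by linarith
    have "(\<Sum>n\<in>L \<inter> {..N}. real n) / 2 =
        (\<Sum>n<N. real (Suc n) * of_bool (Suc n \<in> L) * (1 / 2))"
      using sum_Int_atMost_eq_sum_lessThan[of "\<lambda>_. 1 / 2" L N]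
      by (simp only: sum_distrib_right[symmetric])
    also have "\<dots> \<le> (\<Sum>n<N. real (Suc n) * of_bool (Suc n \<in> L) * r ^ n)"
      using half by (intro sum_mono mult_left_mono) auto
    also have "\<dots> \<le> ?D"
      unfolding sums_unique[OF deriv_power_sum_over_real_sums[OF r]]
      by (rule sum_le_suminf[OF sums_summable[OF deriv_power_sum_over_real_sums[OF r]]])
        (use r in auto)
    also have "\<dots> \<le> 2 * M * real N"
    proof -
      have "(1 - r) * ?D \<le> M"
        using M[of "complex_of_real r"] r by simp
      moreover have "1 - r = 1 / (2 * real N)"
        by (simp add: r_def)
      ultimately show ?thesis
        using False by (simp add: field_simps)
    qed
    finally show ?thesis
      by simp
  qed auto
  then show thesis
    by (rule that)
qed

text \<open>Summation by parts as an induction: since the partial sums of \<open>b\<close> are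
  nonnegative, replacing \<open>w n\<close> by the smaller \<open>w (Suc n)\<close> only lowers the
  left side.\<close>

lemma Abel_sum_lower_bound:
  fixes b w :: "nat \<Rightarrow> real"
  assumes "\<And>n. 0 \<le> sum b {..<n}" and "antimono w"
  shows "w n * sum b {..<n} \<le> (\<Sum>i<n. b i * w i)"
proof (induction n)
  case (Suc n)
  have "w (Suc n) * sum b {..<Suc n} \<le> w n * sum b {..<Suc n}"
    using assms by (intro mult_right_mono) (auto simp: antimono_def simp del: sum.lessThan_Suc)
  also have "\<dots> \<le> (\<Sum>i<Suc n. b i * w i)"
    using Suc by (simp add: algebra_simps)
  finally show ?case .
qed simp

lemma bloch_of_sum_le:
  assumes C: "\<And>N. (\<Sum>n\<in>L \<inter> {..N}. real n) \<le> C * real N"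
  shows "power_sum_over L \<in> bloch_space"
proof -
  have "(1 - norm z) * norm (deriv (power_sum_over L) z) \<le> C" if "norm z < 1" for z
  proof -
    define r where "r = norm z"
    have r: "0 \<le> r" "r < 1"
      using that by (auto simp: r_def)
    define a where "a = (\<lambda>n. real (Suc n) * of_bool (Suc n \<in> L))"
    have "0 \<le> C"
      using C[of 1] sum_nonneg[of "L \<inter> {..1}" real] by simp
    have partial: "sum a {..<N} \<le> C * real N" for N
      using sum_Int_atMost_eq_sum_lessThan[of "\<lambda>_. 1" L N] C[of N] by (simp add: a_def)
    have bound: "(\<Sum>n<N. a n * r ^ n) \<le> C / (1 - r)" for N
    proof -
      \<comment> \<open>Abel summation is applied to \<open>C - a n\<close>, whose partial sums are
        nonnegative by \<open>partial\<close>. Thus \<open>a\<close> may be replaced by the constant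
        \<open>C\<close> against decreasing weights.\<close>
      have "r ^ N * (\<Sum>n<N. C - a n) \<le> (\<Sum>n<N. (C - a n) * r ^ n)"
        using partial r
        by (intro Abel_sum_lower_bound)
          (auto simp: sum_subtractf mult.commute antimono_def intro: power_decreasing)
      moreover have "0 \<le> r ^ N * (\<Sum>n<N. C - a n)"
        using partial[of N] r by (simp add: sum_subtractf mult.commute)
      ultimately have "(\<Sum>n<N. a n * r ^ n) \<le> C * (\<Sum>n<N. r ^ n)"
        by (simp add: left_diff_distrib sum_subtractf sum_distrib_left)
      also have "(\<Sum>n<N. r ^ n) \<le> 1 / (1 - r)"
        using sum_le_suminf[of "\<lambda>n. r ^ n" "{..<N}"] r
        by (simp add: suminf_geometric summable_geometric)
      finally show ?thesis
        using \<open>0 \<le> C\<close> by (simp add: mult_left_mono)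
    qed
    have "norm (\<Sum>n<N. of_nat (Suc n) * of_bool (Suc n \<in> L) * z ^ n) \<le> C / (1 - r)" for N
    proof -
      have "norm (\<Sum>n<N. of_nat (Suc n) * of_bool (Suc n \<in> L) * z ^ n) \<le> (\<Sum>n<N. a n * r ^ n)"
        by (rule sum_norm_le) (auto simp: a_def r_def norm_mult norm_power simp del: of_nat_Suc)
      then show ?thesis
        using bound[of N] by linarith
    qed
    then have "norm (deriv (power_sum_over L) z) \<le> C / (1 - r)"
      using deriv_power_sum_over_sums[OF that, of L] unfolding sums_def
      by (intro Lim_bounded[OF tendsto_norm]) auto
    then show ?thesis
      using r by (simp add: r_def field_simps)
  qed
  then show ?thesis
    unfolding bloch_space_iff using power_sum_over_holomorphic by blast
qed

section \<open>Lacunary sets and linear growth of the sums\<close>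

text \<open>A gap condition on all pairs beyond a threshold replaces the lower limit over the
  enumeration; consecutive elements are the pairs that matter here.\<close>

lemma lacunaryI:
  assumes "1 < q" and gap: "\<And>x y. x \<in> L \<Longrightarrow> y \<in> L \<Longrightarrow> m \<le> x \<Longrightarrow> x < y \<Longrightarrow> q * real x \<le> real y"
  shows "lacunary L"
proof (cases "finite L")
  case False
  have "\<forall>\<^sub>F k in sequentially.
      ereal q \<le> ereal (real (enumerate L (Suc k)) / real (enumerate L k))"
    \<comment> \<open>Since \<open>k \<le> enumerate L k\<close>, this puts the element beyond
      \<open>m\<close> and makes it positive, so the quotient can be cleared.\<close>
    using eventually_ge_at_top[of "Suc m"]
  proof eventually_elim
    case (elim k)
    have "k \<le> enumerate L k"
      using le_enumerate[OF False] by blast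
    with elim gap[of "enumerate L k" "enumerate L (Suc k)"] show ?case
      using False by (simp add: enumerate_in_set enumerate_step field_simps)
  qed
  then have "ereal q \<le> lacunary_ratio L"
    unfolding lacunary_ratio_def by (rule Liminf_bounded)
  moreover have "1 < ereal q"
    using \<open>1 < q\<close> by simp
  ultimately show ?thesis
    unfolding lacunary_def by (blast intro: less_le_trans)
qed (simp add: lacunary_def)

lemma lacunaryE:
  assumes "lacunary L"
  obtains q m where "1 < q"
    and "\<And>x y. x \<in> L \<Longrightarrow> y \<in> L \<Longrightarrow> m \<le> x \<Longrightarrow> x < y \<Longrightarrow> q * real x \<le> real y"
proof (cases "finite L")
  case True
  then have "x < Suc (Max L)" if "x \<in> L" for x
    using that by (simp add: less_Suc_eq_le)
  then show thesis
    \<comment> \<open>No element of a finite set reaches the threshold, so any ratio above 1 would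
      do.\<close>
    by (intro that[of 2 "Suc (Max L)"]) (auto simp: not_less[symmetric])
next
  case False
  then have "1 < lacunary_ratio L"
    using assms by (simp add: lacunary_def)
  then obtain q where q: "1 < q" "ereal q < lacunary_ratio L"
    using ereal_dense2[of 1 "lacunary_ratio L"] by (auto simp: one_ereal_def)
  then have "\<forall>\<^sub>F k in sequentially.
      ereal q < ereal (real (enumerate L (Suc k)) / real (enumerate L k))"
    unfolding lacunary_ratio_def by (intro less_LiminfD)
  then obtain K where K: "\<And>k. K \<le> k \<Longrightarrow> q < real (enumerate L (Suc k)) / real (enumerate L k)"
    by (auto simp: eventually_sequentially)
  show thesis
  proof (rule that[of q "enumerate L K"])
    fix x y
    assume xy: "x \<in> L" "y \<in> L" "enumerate L K \<le> x" "x < y"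
    obtain i j where ij: "x = enumerate L i" "y = enumerate L j"
      using xy enumerate_Ex[OF False] by metis
    have "K \<le> i" "Suc i \<le> j"
      using xy(3,4) False unfolding ij by (simp_all add: Suc_le_eq)
    then have "enumerate L (Suc i) \<le> y" and quot: "q < real (enumerate L (Suc i)) / real x"
      using False K[of i] by (simp_all add: ij)
    \<comment> \<open>If \<open>x\<close> were 0, the quotient would be 0 by convention,
      contradicting \<open>q > 1\<close>.\<close>
    moreover have "0 < x"
      using quot q(1) by (cases "x = 0") auto
    ultimately show "q * real x \<le> real y"
      by (simp add: field_simps)
  qed (rule q)
qed

lemma lacunary_sum_le:
  assumes "lacunary L"
  shows "\<exists>C. \<forall>N. (\<Sum>n\<in>L \<inter> {..N}. real n) \<le> C * real N"
proof -
  obtain q m where q: "1 < q"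
    and gap: "\<And>x y. x \<in> L \<Longrightarrow> y \<in> L \<Longrightarrow> m \<le> x \<Longrightarrow> x < y \<Longrightarrow> q * real x \<le> real y"
    using assms by (rule lacunaryE) blast
  \<comment> \<open>The sum of the geometric series with ratio \<open>1 / q\<close>; the identity
    \<open>c / q + 1 = c\<close> closes the induction below.\<close>
  define c where "c = q / (q - 1)"
  have c: "0 \<le> c" "c / q + 1 = c"
    using q by (auto simp: c_def field_simps)
  have tail: "(\<Sum>n\<in>L \<inter> {m..N}. real n) \<le> c * real N" for N
  proof (induction N rule: less_induct)
    case (less N)
    show ?case
    proof (cases "L \<inter> {m..N} = {}")
      case False
      define y where "y = Max (L \<inter> {m..N})"
      have y: "y \<in> L" "m \<le> y" "y \<le> N"
        using Max_in[of "L \<inter> {m..N}"] False by (auto simp: y_def)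
      have y_max: "n \<le> y" if "n \<in> L" "m \<le> n" "n \<le> N" for n
        unfolding y_def by (rule Max_ge) (use that in auto)
      show ?thesis
      proof (cases "y = 0")
        case True
        then have "L \<inter> {m..N} \<subseteq> {0}"
          using y_max by auto
        then have "(\<Sum>n\<in>L \<inter> {m..N}. real n) \<le> (\<Sum>n\<in>{0}. real n)"
          by (intro sum_mono2) auto
        with c show ?thesis
          by (simp add: order_trans[of _ 0])
      next
        case False
        \<comment> \<open>By the gap condition, every element of \<open>L \<inter> {m..N}\<close>
          other than the largest one, \<open>y\<close>, is at most \<open>x\<close>, and the
          induction hypothesis applies at \<open>x\<close>.\<close>
        define x where "x = nat \<lfloor>real y / q\<rfloor>"
        have x: "real x \<le> real y / q"
          using q by (auto simp: x_def)
        moreover have "real y / q < real y"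
          using q False by (simp add: field_simps)
        ultimately have "x < N"
          using y by linarith
        have "L \<inter> {m..N} - {y} \<subseteq> L \<inter> {m..x}"
        proof safe
          fix n
          assume n: "n \<in> L" "n \<in> {m..N}" "n \<noteq> y"
          then have "q * real n \<le> real y"
            using gap[of n y] y y_max[of n] by auto
          then have "real n \<le> real y / q"
            using q by (simp add: field_simps)
          then show "n \<in> {m..x}"
            using n by (simp add: x_def le_nat_floor)
        qed
        then have "(\<Sum>n\<in>L \<inter> {m..N} - {y}. real n) \<le> (\<Sum>n\<in>L \<inter> {m..x}. real n)"
          by (intro sum_mono2) auto
        also have "\<dots> \<le> c * real x"
          using less.IH[OF \<open>x < N\<close>] .
        also have "\<dots> \<le> c * (real y / q)"
          using x c by (intro mult_left_mono)
        finally have "(\<Sum>n\<in>L \<inter> {m..N}. real n) \<le> (c / q + 1) * real y"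
          using y by (simp add: sum.remove[of _ y] algebra_simps)
        also have "\<dots> \<le> c * real N"
          using y c by (simp add: mult_left_mono)
        finally show ?thesis .
      qed
    qed (use c in auto)
  qed
  \<comment> \<open>Bounds the contribution of the elements below the threshold; it is absorbed into
    the linear bound because \<open>N \<ge> 1\<close>.\<close>
  define d where "d = (\<Sum>n<m. real n)"
  have "(\<Sum>n\<in>L \<inter> {..N}. real n) \<le> (d + c) * real N" for N
  proof (cases "N = 0")
    case False
    have "(\<Sum>n\<in>L \<inter> {..N}. real n) \<le> (\<Sum>n\<in>{..<m} \<union> L \<inter> {m..N}. real n)"
      by (intro sum_mono2) auto
    also have "\<dots> = d + (\<Sum>n\<in>L \<inter> {m..N}. real n)"
      unfolding d_def by (intro sum.union_disjoint) auto
    also have "\<dots> \<le> d * real N + c * real N"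
      using tail[of N] False mult_left_mono[of 1 "real N" d]
      by (simp add: d_def sum_nonneg)
    finally show ?thesis
      by (simp add: distrib_right)
  qed auto
  then show ?thesis
    by blast
qed

lemma Union_lacunary_sum_le:
  assumes "finite F" "\<forall>L\<in>F. lacunary L"
  shows "\<exists>C. \<forall>N. (\<Sum>n\<in>\<Union>F \<inter> {..N}. real n) \<le> C * real N"
  using assms
proof (induction F rule: finite_induct)
  case empty
  show ?case
    by (intro exI[of _ 0]) simp
next
  case (insert L F)
  obtain C D where C: "\<And>N. (\<Sum>n\<in>L \<inter> {..N}. real n) \<le> C * real N"
    and D: "\<And>N. (\<Sum>n\<in>\<Union>F \<inter> {..N}. real n) \<le> D * real N"
    using insert lacunary_sum_le[of L] by auto
  have "(\<Sum>n\<in>\<Union>(insert L F) \<inter> {..N}. real n) \<le> (C + D) * real N" for N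
  proof -
    have "(\<Sum>n\<in>\<Union>(insert L F) \<inter> {..N}. real n) =
        (\<Sum>n\<in>L \<inter> {..N} \<union> (\<Union>F \<inter> {..N}). real n)"
      by (rule sum.cong) auto
    \<comment> \<open>The sets may overlap; the intersection contributes a nonnegative sum.\<close>
    also have "\<dots> \<le> (\<Sum>n\<in>L \<inter> {..N}. real n) + (\<Sum>n\<in>\<Union>F \<inter> {..N}. real n)"
      by (subst sum.union_inter[symmetric]) (auto simp: sum_nonneg)
    also have "\<dots> \<le> (C + D) * real N"
      using C[of N] D[of N] by (simp add: distrib_right)
    finally show ?thesis .
  qed
  then show ?case
    by blast
qed

section \<open>Splitting a set of linear growth into lacunary classes\<close>

lemma finite_Union_lacunary_of_sum_le:
  assumes C: "\<And>N. (\<Sum>n\<in>L \<inter> {..N}. real n) \<le> C * real N"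
  shows "\<exists>F. finite F \<and> (\<forall>K\<in>F. lacunary K) \<and> L = \<Union>F"
proof -
  obtain M :: nat where M: "2 * C < real M"
    using reals_Archimedean2 by blast
  have "0 \<le> C"
    using C[of 1] sum_nonneg[of "L \<inter> {..1}" real] by simp
  with M have "0 < M"
    by (cases "M = 0") auto
  \<comment> \<open>For \<open>n\<close> in \<open>L\<close> this is the position of
    \<open>n\<close> in increasing order, counted from 0, whether \<open>L\<close> is finite or
    infinite.\<close>
  define idx where "idx = (\<lambda>n. card (L \<inter> {..<n}))"
  define P where "P = (\<lambda>i. {n \<in> L. idx n mod M = i})"
  have "lacunary (P i)" for i
  \<comment> \<open>The threshold 1 excludes \<open>x = 0\<close>, where the final comparison of
    \<open>M * x\<close> with \<open>2 * C * x\<close> would give no contradiction.\<close>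
  proof (rule lacunaryI[of 2 _ 1])
    fix x y
    assume "x \<in> P i" "y \<in> P i" and x: "1 \<le> x" and "x < y"
    then have xy: "x \<in> L" "y \<in> L" "idx x mod M = idx y mod M"
      by (auto simp: P_def)
    show "2 * real x \<le> real y"
    proof (rule ccontr)
      assume "\<not> 2 * real x \<le> real y"
      then have y: "y \<le> 2 * x"
        by linarith
      have "idx y = card (L \<inter> {..<x} \<union> L \<inter> {x..<y})"
        unfolding idx_def using \<open>x < y\<close> by (intro arg_cong[where f = card]) auto
      also have "\<dots> = idx x + card (L \<inter> {x..<y})"
        unfolding idx_def by (intro card_Un_disjoint) auto
      finally have idx_y: "idx y = idx x + card (L \<inter> {x..<y})" .
      \<comment> \<open>Congruent indices force the number of elements in \<open>{x..<y}\<close> to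
        be a multiple of \<open>M\<close>; it is positive because \<open>x\<close> is
        counted.\<close>
      then have "M dvd card (L \<inter> {x..<y})"
        using xy(3) mod_eq_dvd_iff_nat[of "idx x" "idx y" M] by simp
      moreover have "0 < card (L \<inter> {x..<y})"
        using xy \<open>x < y\<close> by (auto simp: card_gt_0_iff)
      ultimately have "M \<le> card (L \<inter> {x..<y})"
        by (rule dvd_imp_le)
      \<comment> \<open>At least \<open>M\<close> elements, each at least \<open>x\<close>, lie
        below \<open>2 * x\<close>, whereas the growth bound there is only
        \<open>2 * C * x\<close>.\<close>
      then have "real M * real x \<le> real (card (L \<inter> {x..<y})) * real x"
        by (intro mult_right_mono) auto
      also have "\<dots> = (\<Sum>n\<in>L \<inter> {x..<y}. real x)"
        by simp
      also have "\<dots> \<le> (\<Sum>n\<in>L \<inter> {x..<y}. real n)"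
        by (intro sum_mono) auto
      also have "\<dots> \<le> (\<Sum>n\<in>L \<inter> {..2 * x}. real n)"
        using y by (intro sum_mono2) auto
      also have "\<dots> \<le> 2 * C * real x"
        using C[of "2 * x"] by simp
      finally show False
        using M x by simp
    qed
  qed simp
  moreover have "L = \<Union>(P ` {..<M})"
    using \<open>0 < M\<close> by (auto simp: P_def)
  ultimately show ?thesis
    by (intro exI[of _ "P ` {..<M}"]) auto
qed

theorem proposition1p2:
  fixes \<Lambda> :: "nat set"
  shows "power_sum_over \<Lambda> \<in> bloch_space \<longleftrightarrow>
    (\<exists>F. finite F \<and> (\<forall>L\<in>F. lacunary L) \<and> \<Lambda> = \<Union>F)"
proof
  assume "power_sum_over \<Lambda> \<in> bloch_space"
  then obtain C :: real where "\<And>N. (\<Sum>n\<in>\<Lambda> \<inter> {..N}. real n) \<le> C * real N"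
    by (rule sum_le_of_bloch) blast
  then show "\<exists>F. finite F \<and> (\<forall>L\<in>F. lacunary L) \<and> \<Lambda> = \<Union>F"
    by (rule finite_Union_lacunary_of_sum_le)
next
  assume "\<exists>F. finite F \<and> (\<forall>L\<in>F. lacunary L) \<and> \<Lambda> = \<Union>F"
  then obtain C where "\<And>N. (\<Sum>n\<in>\<Lambda> \<inter> {..N}. real n) \<le> C * real N"
    using Union_lacunary_sum_le by blast
  then show "power_sum_over \<Lambda> \<in> bloch_space"
    by (rule bloch_of_sum_le)
qed

end
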